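(* A finite set $S \subseteq \mathbb{R}^2$ has finite order if and only if it is one of the following: (1) the empty set; (2) a set of collinear points; (3) a set of collinear points together with one additional point not collinear with them; (4) the set of vertices of a parallelogram; (5) the set consisting of the vertices of a parallelogram and the intersection point of its two diagonals.
   Context: For a set $S \subseteq \mathbb{R}^2$, let $L = \{L_i\}_{i\in I}$ be the set of lines passing through pairs of (distinct) points of $S$. Define $\mathcal{T}(S) = \bigcup_{i \neq j} L_i \cap L_j \subseteq \mathbb{R}^2$, i.e. the set of intersection points between pairs of distinct lines in $L$. If $S$ is empty or consists of collinear points, then $\mathcal{T}(S) = \emptyset$. The iterates are $\mathcal{T}^0(S) = S$ and $\mathcal{T}^{i+1}(S) = \mathcal{T}(\mathcal{T}^i(S))$. The order of $S$ is the smallest positive integer $n$ such that $\mathcal{T}^n(S) = \mathcal{T}^{n-1}(S)$; if there is no such $n$, the order of $S$ is $\infty$. Parallelograms are nondegenerate. *)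

theory Defs
  imports "HOL-Analysis.Analysis" "HOL-Library.Extended_Nat"
begin

definition spanned_lines :: "(real^2) set \<Rightarrow> (real^2) set set" where
  "spanned_lines S = {affine hull {p, q} | p q. p \<in> S \<and> q \<in> S \<and> p \<noteq> q}"

definition line_intersections :: "(real^2) set \<Rightarrow> (real^2) set" where
  "line_intersections S =
     \<Union> {L \<inter> M | L M. L \<in> spanned_lines S \<and> M \<in> spanned_lines S \<and> L \<noteq> M}"

definition intersection_order :: "(real^2) set \<Rightarrow> enat" where
  "intersection_order S =
     (let stable = (\<lambda>n. 0 < n \<and>
        (line_intersections ^^ n) S = (line_intersections ^^ (n - 1)) S)
      in if \<exists>n. stable n then enat (LEAST n. stable n) else \<infinity>)"

text \<open>Vertices are listed in cyclic order, so the sides are \<open>ab\<close>, \<open>bc\<close>, \<open>cd\<close>, \<open>da\<close> and the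
  diagonals are \<open>ac\<close>, \<open>bd\<close>. The relation \<open>affine_parallel\<close> (being translates) holds
  between a line and itself but never between a line and a point; non-collinearity of
  \<open>a\<close>, \<open>b\<close>, \<open>c\<close> therefore excludes every degenerate case.\<close>

definition parallelogram :: "real^2 \<Rightarrow> real^2 \<Rightarrow> real^2 \<Rightarrow> real^2 \<Rightarrow> bool" where
  "parallelogram a b c d \<longleftrightarrow>
     \<not> collinear {a, b, c} \<and>
     affine_parallel (affine hull {a, b}) (affine hull {c, d}) \<and>
     affine_parallel (affine hull {b, c}) (affine hull {d, a})"

end

theory Submission
  imports Defs
begin

text \<open>
  Write \<open>T\<close> for \<^const>\<open>line_intersections\<close>. A non-collinear set satisfies \<open>S \<subseteq> T(S)\<close>, because each
  of its points is a vertex of a nondegenerate triangle in the set and hence the meet of two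
  spanned lines. The iterates of a finite non-collinear set \<open>S\<close> therefore form an increasing
  chain of finite sets, and a finite order means that the chain ends in a finite set
  \<open>F \<supseteq> S\<close> with \<open>T(F) = F\<close>. Everything rests on describing these \<open>F\<close>
  (\<open>finite_fixed_set_cases\<close>): either all but one point of \<open>F\<close> are collinear, or \<open>F\<close> is a
  parallelogram with its centre. The non-collinear subsets of such an \<open>F\<close> are exactly the
  non-collinear sets in the theorem, and conversely these are stable after at most one step.

  To describe \<open>F\<close>, choose a triangle \<open>abc\<close> of maximal area with vertices in \<open>F\<close>, and use affine
  coordinates in which \<open>a\<close>, \<open>b\<close>, \<open>c\<close> are the origin and the two unit points. Maximality
  gives \<open>\<bar>x\<bar> \<le> 1\<close> and \<open>\<bar>y\<bar> \<le> 1\<close> on \<open>F\<close>. Suppose that a point \<open>p\<close> of \<open>F\<close> lies beyond the side \<open>bc\<close>.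
  If \<open>p\<close> is not \<open>(1, 1)\<close>, then the line \<open>bp\<close> or \<open>cp\<close> meets an axis, at a point of \<open>F\<close> that violates
  these bounds. So \<open>p = (1, 1)\<close>, and maximality confines \<open>F\<close> to the unit square. From any
  point of \<open>F\<close> other than the corners and the centre, meets with lines through these five points lead to a
  point \<open>(t, 0)\<close> with \<open>0 < t < 1\<close>, and further meets produce
  \<open>(t\<^sup>2, 0)\<close>, then \<open>(t\<^sup>4, 0)\<close> and so on, contradicting finiteness. If no point lies beyond any side, then
  \<open>F\<close> lies in the triangle; two points of \<open>F\<close> inside different sides would generate points
  outside the triangle, and a point in the interior of the triangle would project to two such
  points. So all points of \<open>F\<close> except one vertex lie on one side.
\<close>

section \<open>Lines in the plane and their intersections\<close>

text \<open>Twice the signed area of the triangle \<open>pqr\<close>.\<close>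
definition area :: "real^2 \<Rightarrow> real^2 \<Rightarrow> real^2 \<Rightarrow> real" where
  "area p q r = (q$1 - p$1) * (r$2 - p$2) - (q$2 - p$2) * (r$1 - p$1)"

lemma collinear_iff_area: "collinear {p, q, r} \<longleftrightarrow> area p q r = 0"
proof (cases "p = q")
  case True
  then show ?thesis by (simp add: area_def)
next
  case False
  have "collinear {p, q, r} \<longleftrightarrow> (\<exists>u. r = p + u *\<^sub>R (q - p))"
    using collinear_3_affine_hull[OF False, of r] by (auto simp: affine_hull_2_alt)
  also have "\<dots> \<longleftrightarrow> area p q r = 0"
  proof
    assume "\<exists>u. r = p + u *\<^sub>R (q - p)"
    then show "area p q r = 0" by (auto simp: area_def)
  next
    assume a: "area p q r = 0"
    show "\<exists>u. r = p + u *\<^sub>R (q - p)"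
    proof (cases "q$1 = p$1")
      case True
      with False have "q$2 \<noteq> p$2" by (simp add: vec_eq_iff forall_2)
      with a True show ?thesis
        by (intro exI[of _ "(r$2 - p$2) / (q$2 - p$2)"]) (simp add: area_def vec_eq_iff forall_2)
    next
      case False
      define u where "u = (r$1 - p$1) / (q$1 - p$1)"
      have "r$1 - p$1 = u * (q$1 - p$1)" using False by (simp add: u_def)
      moreover have "r$2 - p$2 = u * (q$2 - p$2)"
        using a False by (simp add: u_def area_def field_simps)
      ultimately have "r = p + u *\<^sub>R (q - p)" by (simp add: vec_eq_iff forall_2)
      then show ?thesis ..
    qed
  qed
  finally show ?thesis .
qed

lemma mem_line_iff_area: "p \<noteq> q \<Longrightarrow> x \<in> affine hull {p, q} \<longleftrightarrow> area p q x = 0"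
  using collinear_3_affine_hull collinear_iff_area by blast

lemma not_collinear_obtains:
  assumes "\<not> collinear S" "p \<in> S"
  obtains q r where "q \<in> S" "r \<in> S" "area p q r \<noteq> 0"
proof -
  obtain q where q: "q \<in> S" "q \<noteq> p"
    using assms by (metis collinear_sing insertI1 insert_absorb is_singletonI' is_singleton_the_elem)
  have "insert p (insert q S) = S" using assms q by auto
  with assms collinear_triples[of p q S] q obtain r where "r \<in> S" "\<not> collinear {p, q, r}"
    by auto
  with q that show ?thesis by (auto simp: collinear_iff_area)
qed

lemma line_eqI:
  assumes "L = affine hull {p, q}" "p \<noteq> q" "x \<in> L" "y \<in> L" "x \<noteq> y"
  shows "L = affine hull {x, y}"
proof
  have coll: "collinear L"
    using assms(1) by (simp add: collinear_affine_hull_collinear)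
  have "z \<in> affine hull {x, y}" if "z \<in> L" for z
  proof -
    have "collinear {x, y, z}" using coll assms(3,4) that by (auto intro: collinear_subset)
    then show ?thesis using assms(5) by (simp add: collinear_3_affine_hull)
  qed
  then show "L \<subseteq> affine hull {x, y}" by blast
  show "affine hull {x, y} \<subseteq> L"
    using assms(1,3,4) by (simp add: hull_minimal)
qed

lemma distinct_lines_meet_once:
  assumes "L \<in> spanned_lines S" "M \<in> spanned_lines S" "L \<noteq> M" "x \<in> L" "x \<in> M" "y \<in> L" "y \<in> M"
  shows "x = y"
proof (rule ccontr)
  assume "x \<noteq> y"
  have "K = affine hull {x, y}" if K: "K \<in> spanned_lines S" "x \<in> K" "y \<in> K" for K
  proof -
    obtain p q where "K = affine hull {p, q}" "p \<noteq> q"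
      using K(1) by (auto simp: spanned_lines_def)
    then show ?thesis using K(2,3) \<open>x \<noteq> y\<close> by (rule line_eqI)
  qed
  then show False using assms by metis
qed

lemma finite_line_intersections:
  assumes "finite S"
  shows "finite (line_intersections S)"
proof -
  have "spanned_lines S \<subseteq> (\<lambda>(p, q). affine hull {p, q}) ` (S \<times> S)"
    by (auto simp: spanned_lines_def)
  then have lines: "finite (spanned_lines S)"
    using assms by (meson finite_SigmaI finite_imageI finite_subset)
  have "{L \<inter> M | L M. L \<in> spanned_lines S \<and> M \<in> spanned_lines S \<and> L \<noteq> M}
      \<subseteq> (\<lambda>(L, M). L \<inter> M) ` (spanned_lines S \<times> spanned_lines S)" by auto
  then have "finite {L \<inter> M | L M. L \<in> spanned_lines S \<and> M \<in> spanned_lines S \<and> L \<noteq> M}"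
    using lines by (meson finite_SigmaI finite_imageI finite_subset)
  moreover have "finite (L \<inter> M)" if "L \<in> spanned_lines S" "M \<in> spanned_lines S" "L \<noteq> M" for L M
  proof (cases "L \<inter> M = {}")
    case False
    then obtain u where "u \<in> L \<inter> M" by blast
    then have "L \<inter> M \<subseteq> {u}" using distinct_lines_meet_once[OF that] by blast
    then show ?thesis by (rule finite_subset) simp
  qed simp
  ultimately show ?thesis unfolding line_intersections_def by blast
qed

lemma line_intersections_mono: "S \<subseteq> T \<Longrightarrow> line_intersections S \<subseteq> line_intersections T"
  unfolding line_intersections_def spanned_lines_def by blast

text \<open>The last premise says that the directions \<open>q - p\<close> and \<open>s - r\<close> are linearly independent,
  which makes the two lines distinct and forces \<open>p \<noteq> q\<close> and \<open>r \<noteq> s\<close>.\<close>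
lemma line_intersectionsI:
  assumes "p \<in> S" "q \<in> S" "r \<in> S" "s \<in> S" "area p q x = 0" "area r s x = 0"
    "(q$1 - p$1) * (s$2 - r$2) \<noteq> (q$2 - p$2) * (s$1 - r$1)"
  shows "x \<in> line_intersections S"
proof -
  have ne: "p \<noteq> q" "r \<noteq> s" using assms(7) by auto
  have "affine hull {p, q} \<noteq> affine hull {r, s}"
  proof
    assume "affine hull {p, q} = affine hull {r, s}"
    then have "area r s p = 0" "area r s q = 0"
      using mem_line_iff_area[OF ne(2)] by (auto simp: hull_inc)
    then show False using assms(7) by (simp add: area_def algebra_simps)
  qed
  moreover have "affine hull {p, q} \<in> spanned_lines S" "affine hull {r, s} \<in> spanned_lines S"
    using assms ne by (auto simp: spanned_lines_def)
  moreover have "x \<in> affine hull {p, q} \<inter> affine hull {r, s}"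
    using assms ne by (simp add: mem_line_iff_area)
  ultimately show ?thesis unfolding line_intersections_def by blast
qed

text \<open>A point of \<open>S\<close> forms a nondegenerate triangle with two others, so two distinct spanned lines
  pass through it.\<close>
lemma subset_line_intersections:
  assumes "\<not> collinear S"
  shows "S \<subseteq> line_intersections S"
proof
  fix p assume p: "p \<in> S"
  then obtain q r where qr: "q \<in> S" "r \<in> S" "area p q r \<noteq> 0"
    using assms not_collinear_obtains by blast
  then show "p \<in> line_intersections S"
    using p by (intro line_intersectionsI[of p S q p r]) (auto simp: area_def)
qed

lemma line_intersections_collinear:
  assumes "collinear S"
  shows "line_intersections S = {}"
proof -
  have "affine hull {p, q} \<subseteq> affine hull {r, s}"
    if "p \<in> S" "q \<in> S" "r \<in> S" "s \<in> S" "r \<noteq> s" for p q r s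
  proof -
    have "collinear {r, s, p}" "collinear {r, s, q}"
      using assms that by (auto intro: collinear_subset)
    then show ?thesis using that
      by (simp add: collinear_3_affine_hull affine_affine_hull hull_minimal)
  qed
  then show ?thesis unfolding line_intersections_def spanned_lines_def by blast
qed

section \<open>Affine coordinates\<close>

text \<open>The point whose affine coordinates are \<open>z\<close> when \<open>a\<close>, \<open>b\<close>, \<open>c\<close> are given the coordinates
  \<open>(0, 0)\<close>, \<open>(1, 0)\<close>, \<open>(0, 1)\<close>.\<close>
definition frame :: "real^2 \<Rightarrow> real^2 \<Rightarrow> real^2 \<Rightarrow> real \<times> real \<Rightarrow> real^2" where
  "frame a b c z = a + fst z *\<^sub>R (b - a) + snd z *\<^sub>R (c - a)"

lemma frame_nth: "frame a b c (x, y) $ i = a$i + x * (b$i - a$i) + y * (c$i - a$i)"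
  by (simp add: frame_def)

lemma area_frame:
  "area (frame a b c (p1, p2)) (frame a b c (q1, q2)) (frame a b c (r1, r2)) =
    area a b c * ((q1 - p1) * (r2 - p2) - (q2 - p2) * (r1 - p1))"
  unfolding area_def frame_nth by algebra

lemma frame_coordinates:
  assumes "area a b c \<noteq> 0"
  obtains x y where "p = frame a b c (x, y)"
proof (rule that)
  \<comment> \<open>Cramer's rule\<close>
  show "p = frame a b c (area a p c / area a b c, area a b p / area a b c)"
    unfolding vec_eq_iff forall_2 frame_nth using assms
    by (simp add: field_simps) (simp add: area_def algebra_simps)
qed

lemma frame_eq_iff:
  assumes "area a b c \<noteq> 0"
  shows "frame a b c (x, y) = frame a b c (x', y') \<longleftrightarrow> x = x' \<and> y = y'"
proof
  let ?f = "frame a b c"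
  assume eq: "?f (x, y) = ?f (x', y')"
  have "area (?f (0,0)) (?f (1,0)) (?f (x,y)) = area (?f (0,0)) (?f (1,0)) (?f (x',y'))"
       "area (?f (0,0)) (?f (0,1)) (?f (x,y)) = area (?f (0,0)) (?f (0,1)) (?f (x',y'))"
    using eq by auto
  then show "x = x' \<and> y = y'" using assms by (simp add: area_frame)
qed simp

text \<open>The coordinate form of \<open>line_intersections F \<subseteq> F\<close>: the line through \<open>p\<close> and \<open>q\<close> is not
  parallel to the line through \<open>r\<close> and \<open>s\<close>, and \<open>(x, y)\<close> lies on both. Spelling this out by
  polynomial identities between coordinates leaves only field arithmetic to be checked whenever
  a new point is constructed.\<close>
definition meet_closed :: "(real \<times> real) set \<Rightarrow> bool" where
  "meet_closed G \<longleftrightarrow> (\<forall>p1 p2 q1 q2 r1 r2 s1 s2 x y.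
     (p1, p2) \<in> G \<longrightarrow> (q1, q2) \<in> G \<longrightarrow> (r1, r2) \<in> G \<longrightarrow> (s1, s2) \<in> G \<longrightarrow>
     (q1 - p1) * (s2 - r2) \<noteq> (q2 - p2) * (s1 - r1) \<longrightarrow>
     (q1 - p1) * (y - p2) = (q2 - p2) * (x - p1) \<longrightarrow>
     (s1 - r1) * (y - r2) = (s2 - r2) * (x - r1) \<longrightarrow> (x, y) \<in> G)"

lemma meet_closedD:
  assumes "(p1, p2) \<in> G" "(q1, q2) \<in> G" "(r1, r2) \<in> G" "(s1, s2) \<in> G" "meet_closed G"
    "(q1 - p1) * (s2 - r2) \<noteq> (q2 - p2) * (s1 - r1)"
    "(q1 - p1) * (y - p2) = (q2 - p2) * (x - p1)"
    "(s1 - r1) * (y - r2) = (s2 - r2) * (x - r1)"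
  shows "(x, y) \<in> G"
  using assms unfolding meet_closed_def by blast

lemma meet_closed_frame:
  assumes "line_intersections F \<subseteq> F" "area a b c \<noteq> 0"
  shows "meet_closed (frame a b c -` F)"
  unfolding meet_closed_def
proof (intro allI impI)
  let ?f = "frame a b c"
  fix p1 p2 q1 q2 r1 r2 s1 s2 x y
  assume mem: "(p1, p2) \<in> ?f -` F" "(q1, q2) \<in> ?f -` F" "(r1, r2) \<in> ?f -` F" "(s1, s2) \<in> ?f -` F"
    and cross: "(q1 - p1) * (s2 - r2) \<noteq> (q2 - p2) * (s1 - r1)"
    and on: "(q1 - p1) * (y - p2) = (q2 - p2) * (x - p1)"
      "(s1 - r1) * (y - r2) = (s2 - r2) * (x - r1)"
  have "(?f (q1,q2)$1 - ?f (p1,p2)$1) * (?f (s1,s2)$2 - ?f (r1,r2)$2)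
      - (?f (q1,q2)$2 - ?f (p1,p2)$2) * (?f (s1,s2)$1 - ?f (r1,r2)$1)
    = area a b c * ((q1 - p1) * (s2 - r2) - (q2 - p2) * (s1 - r1))"
    unfolding frame_nth area_def by algebra
  then have "?f (x, y) \<in> line_intersections F"
    using mem cross on assms(2)
    by (intro line_intersectionsI[of "?f (p1,p2)" F "?f (q1,q2)" "?f (r1,r2)" "?f (s1,s2)"])
      (auto simp: area_frame)
  with assms(1) show "(x, y) \<in> ?f -` F" by auto
qed


section \<open>Closed sets inside a triangle\<close>

text \<open>Call the corners \<open>a = (0, 0)\<close>, \<open>b = (1, 0)\<close>, \<open>c = (0, 1)\<close> and the two edge points
  \<open>p = (s, 0)\<close>, \<open>q = (0, t)\<close>. Two points inside different edges span a line that must be parallel to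
  the third edge, as it would otherwise meet the line of that edge outside the triangle. This forces
  the points inside the edges to be the midpoints, but a further meet then yields a point that divides
  \<open>bc\<close> in the ratio \<open>1 : 2\<close>.\<close>
lemma triangle_not_both_edges:
  assumes G: "meet_closed G" "(0, 0) \<in> G" "(1, 0) \<in> G" "(0, 1) \<in> G"
    and G_triangle: "\<And>x y. (x, y) \<in> G \<Longrightarrow> 0 \<le> x \<and> 0 \<le> y \<and> x + y \<le> 1"
    and st: "(s, 0) \<in> G" "(0, t) \<in> G" "0 < s" "s < 1" "0 < t" "t < 1"
  shows False
proof -
  have "s = t"
  proof (rule ccontr)
    assume "s \<noteq> t"
    then have "(s * (t - 1) / (t - s), t * (1 - s) / (t - s)) \<in> G"
      by (intro meet_closedD[OF st(1,2) G(3,4,1)]) (simp_all add: divide_simps, simp_all add: algebra_simps)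
    from G_triangle[OF this] have "s * (t - 1) / (t - s) \<ge> 0" "t * (1 - s) / (t - s) \<ge> 0" by auto
    moreover have "s * (t - 1) < 0" "t * (1 - s) > 0" using st by (auto simp: mult_less_0_iff)
    ultimately show False using \<open>s \<noteq> t\<close> by (simp add: zero_le_divide_iff)
  qed
  \<comment> \<open>The cevians \<open>bq\<close> and \<open>cp\<close> meet on the median from \<open>a\<close>, whose foot is the midpoint of \<open>bc\<close>.\<close>
  have "(t / (1 + t), t / (1 + t)) \<in> G"
  proof (rule meet_closedD[OF G(3) st(2) G(4) st(1) G(1)])
    show "(0 - 1) * (0 - 1) \<noteq> (t - 0) * (s - 0)"
      using st mult_strict_mono[of t 1 s 1] by simp
  qed (use st \<open>s = t\<close> in \<open>simp_all add: field_simps\<close>)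
  then have mid: "(1/2, 1/2) \<in> G"
    by (rule meet_closedD[OF G(2) _ G(3,4,1)]) (use st in \<open>simp_all add: field_simps\<close>)
  \<comment> \<open>The line through \<open>q\<close> and that midpoint has to be parallel to \<open>ab\<close>.\<close>
  have "t = 1/2"
  proof (rule ccontr)
    assume "t \<noteq> 1/2"
    then have "(t / (2 * t - 1), 0) \<in> G"
      by (intro meet_closedD[OF mid st(2) G(2,3,1)]) (simp_all add: field_simps)
    from G_triangle[OF this] have "0 \<le> t / (2 * t - 1)" "t / (2 * t - 1) \<le> 1" by auto
    then show False
      using st \<open>t \<noteq> 1/2\<close> by (cases "2 * t - 1 > 0") (auto simp: zero_le_divide_iff divide_le_eq)
  qed
  \<comment> \<open>The segment from \<open>p\<close> to the midpoint of \<open>bc\<close> meets the median \<open>bq\<close>; this point is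
    projected from \<open>a\<close> to \<open>bc\<close>.\<close>
  have "(1/2, 1/4) \<in> G"
    by (rule meet_closedD[OF mid st(1) G(3) st(2) G(1)])
      (simp_all add: \<open>s = t\<close> \<open>t = 1/2\<close>)
  then have two_thirds: "(2/3, 1/3) \<in> G"
    by (rule meet_closedD[OF G(2) _ G(3,4,1)]) simp_all
  have "(2, 0) \<in> G"
    by (rule meet_closedD[OF two_thirds st(2) G(2,3,1)]) (simp_all add: \<open>t = 1/2\<close>)
  from G_triangle[OF this] show False by simp
qed

text \<open>A point in the interior projects from two corners to points inside the two opposite edges,
  which is impossible. Points inside any two different edges lie on cevians that meet in the
  interior. So at most one edge has points in its relative interior.\<close>
lemma triangle_all_but_one_on_edge:
  assumes G: "meet_closed G" "(0, 0) \<in> G" "(1, 0) \<in> G" "(0, 1) \<in> G"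
    and G_triangle: "\<And>x y. (x, y) \<in> G \<Longrightarrow> 0 \<le> x \<and> 0 \<le> y \<and> x + y \<le> 1"
  shows "(\<forall>x y. (x, y) \<in> G \<longrightarrow> (x, y) = (1, 0) \<or> x = 0) \<or>
    (\<forall>x y. (x, y) \<in> G \<longrightarrow> (x, y) = (0, 1) \<or> y = 0) \<or>
    (\<forall>x y. (x, y) \<in> G \<longrightarrow> (x, y) = (0, 0) \<or> x + y = 1)"
proof -
  have interior: False if xy: "(x, y) \<in> G" "0 < x" "0 < y" "x + y < 1" for x y
  proof -
    have 1: "(x / (1 - y), 0) \<in> G"
      by (rule meet_closedD[OF G(4) xy(1) G(2,3,1)]) (use xy in \<open>simp_all add: field_simps\<close>)
    have 2: "(0, y / (1 - x)) \<in> G"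
      by (rule meet_closedD[OF G(3) xy(1) G(2,4,1)]) (use xy in \<open>simp_all add: field_simps\<close>)
    show False
      by (rule triangle_not_both_edges[OF G G_triangle 1 2])
        (use xy in \<open>simp_all add: field_simps\<close>)
  qed
  have edges_xy: False if "(s, 0) \<in> G" "(0, t) \<in> G" "0 < s" "s < 1" "0 < t" "t < 1" for s t
    using triangle_not_both_edges[OF G G_triangle] that by blast
  have edges_x: False if s: "(s, 0) \<in> G" "(t, 1 - t) \<in> G" "0 < s" "s < 1" "0 < t" "t < 1" for s t
  proof -
    \<comment> \<open>\<open>D\<close> is the common denominator of the meet of the cevians from \<open>(0, 1)\<close> to \<open>(s, 0)\<close> and from
      \<open>(0, 0)\<close> to \<open>(t, 1 - t)\<close>.\<close>
    define D where "D = t + s * (1 - t)"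
    have D: "D > 0" using s by (simp add: D_def add_pos_pos)
    have "(s * t / D, s * (1 - t) / D) \<in> G"
      by (rule meet_closedD[OF G(4) s(1) G(2) s(2) G(1)])
        (use D in \<open>simp_all add: divide_simps\<close>, simp_all add: D_def algebra_simps)
    moreover have "s * t < t" "s * t > 0" "s * (1 - t) > 0" using s by simp_all
    ultimately show False
      using D by (intro interior[of "s * t / D" "s * (1 - t) / D"])
       (simp_all add: add_divide_distrib[symmetric], simp add: D_def)
  qed
  have edges_y: False if s: "(0, s) \<in> G" "(t, 1 - t) \<in> G" "0 < s" "s < 1" "0 < t" "t < 1" for s t
  proof -
    define D where "D = (1 - t) + s * t"
    have D: "D > 0" using s by (simp add: D_def add_pos_pos)
    have "(s * t / D, s * (1 - t) / D) \<in> G"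
      by (rule meet_closedD[OF G(3) s(1) G(2) s(2) G(1)])
        (use D in \<open>simp_all add: divide_simps\<close>, simp_all add: D_def algebra_simps)
    moreover have "s * (1 - t) < 1 - t" "s * t > 0" "s * (1 - t) > 0" using s by simp_all
    ultimately show False
      using D by (intro interior[of "s * t / D" "s * (1 - t) / D"])
       (simp_all add: add_divide_distrib[symmetric], simp add: D_def)
  qed
  have boundary: "x = 0 \<or> y = 0 \<or> x + y = 1" if "(x, y) \<in> G" for x y
    using interior[of x y] G_triangle[OF that] that by force
  have corner: "0 < x \<and> x < 1 \<and> 0 < y \<and> y < 1 \<or> (x, y) \<in> {(1, 0), (0, 1)}"
    if "(x, y) \<in> G" "x + y = 1" for x y
    using G_triangle[OF that(1)] that(2) by force
  have on_hypotenuse: "(x, 1 - x) \<in> G" if "(x, y) \<in> G" "x + y = 1" for x y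
    using that by (metis add_diff_cancel_left')
  consider (bottom) s where "(s, 0) \<in> G" "0 < s" "s < 1"
    | (left) s where "(0, s) \<in> G" "0 < s" "s < 1"
    | (neither) "\<And>s. 0 < s \<Longrightarrow> s < 1 \<Longrightarrow> (s, 0) \<notin> G \<and> (0, s) \<notin> G"
    by blast
  then show ?thesis
  proof cases
    case bottom
    have "(x, y) = (0, 1) \<or> y = 0" if xy: "(x, y) \<in> G" for x y
    proof (cases "x + y = 1")
      case True
      then show ?thesis using corner[OF xy] edges_x[OF bottom(1) on_hypotenuse[OF xy]] bottom by auto
    next
      case False
      then show ?thesis
        using boundary[OF xy] G_triangle[OF xy] edges_xy[OF bottom(1), of y] xy bottom by force
    qed
    then show ?thesis by blast
  next
    case left
    have "(x, y) = (1, 0) \<or> x = 0" if xy: "(x, y) \<in> G" for x y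
    proof (cases "x + y = 1")
      case True
      then show ?thesis using corner[OF xy] edges_y[OF left(1) on_hypotenuse[OF xy]] left by auto
    next
      case False
      then show ?thesis
        using boundary[OF xy] G_triangle[OF xy] edges_xy[OF _ left(1), of x] xy left by force
    qed
    then show ?thesis by blast
  next
    case neither
    have "(x, y) = (0, 0) \<or> x + y = 1" if xy: "(x, y) \<in> G" for x y
      using boundary[OF xy] G_triangle[OF xy] neither[of x] neither[of y] xy by force
    then show ?thesis by blast
  qed
qed

section \<open>Closed sets inside a square\<close>

text \<open>A point \<open>(t, 0)\<close> generates \<open>(t\<^sup>2, 0)\<close>: reflect \<open>(t, 0)\<close> through the centre to \<open>(1 - t, 1)\<close>, take the
  point where the line from \<open>(0, 1)\<close> to \<open>(t, 0)\<close> meets the diagonal, and join the two. Hence no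
  smallest such \<open>t\<close> exists in the open unit interval.\<close>
lemma square_bottom_edge:
  assumes G: "meet_closed G" "(0, 0) \<in> G" "(1, 0) \<in> G" "(0, 1) \<in> G" "(1, 1) \<in> G"
    and "finite G" "(t, 0) \<in> G" "0 < t" "t < 1"
  shows False
proof -
  have mid: "(1/2, 1/2) \<in> G"
    by (rule meet_closedD[OF G(2,5,3,4,1)]) auto
  have square: "(t^2, 0) \<in> G" if t: "(t, 0) \<in> G" "0 < t" "t < 1" for t
  proof -
    have opp: "(1 - t, 1) \<in> G"
      by (rule meet_closedD[OF t(1) mid G(4,5,1)]) (simp_all add: field_simps)
    have diag: "(t / (1 + t), t / (1 + t)) \<in> G"
      by (rule meet_closedD[OF G(4) t(1) G(2,5,1)]) (use t in \<open>simp_all add: field_simps\<close>)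
    show ?thesis
      by (rule meet_closedD[OF opp diag G(2,3,1)])
        (use t in \<open>simp_all add: divide_simps\<close>, (simp add: algebra_simps power2_eq_square)+)
  qed
  define E where "E = {t. (t, 0) \<in> G \<and> 0 < t \<and> t < 1}"
  have "E = fst ` (G \<inter> {0<..<1} \<times> {0})" by (force simp: E_def)
  then have "finite E" using \<open>finite G\<close> by simp
  moreover have "E \<noteq> {}" using assms by (auto simp: E_def)
  ultimately have "Min E \<in> E" "\<And>t. t \<in> E \<Longrightarrow> Min E \<le> t" by auto
  moreover have "u^2 \<in> E" "u^2 < u" if "u \<in> E" for u
    using square[of u] that
    by (auto simp: E_def power2_eq_square mult_less_cancel_left1 power_less_one_iff[of u 2, unfolded power2_eq_square])
  ultimately show False by (meson not_less)
qed

text \<open>Points inside the other edges can be carried to the bottom edge by reflection through the centre and by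
  reflection in the diagonal, both of which are compositions of meets. Every other point of the
  square except the centre projects from a corner to a point inside some edge.\<close>
lemma square_only_corners_and_centre:
  assumes G: "meet_closed G" "(0, 0) \<in> G" "(1, 0) \<in> G" "(0, 1) \<in> G" "(1, 1) \<in> G"
    and "finite G"
    and G_square: "\<And>x y. (x, y) \<in> G \<Longrightarrow> 0 \<le> x \<and> x \<le> 1 \<and> 0 \<le> y \<and> y \<le> 1"
  shows "G = {(0, 0), (1, 0), (0, 1), (1, 1), (1/2, 1/2)}"
proof -
  have mid: "(1/2, 1/2) \<in> G"
    by (rule meet_closedD[OF G(2,5,3,4,1)]) auto
  have bottom: False if "(t, 0) \<in> G" "0 < t" "t < 1" for t
    using square_bottom_edge[OF G \<open>finite G\<close> that] .
  have left: False if t: "(0, t) \<in> G" "0 < t" "t < 1" for t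
  proof -
    have diag: "(t / (1 + t), t / (1 + t)) \<in> G"
      by (rule meet_closedD[OF G(3) t(1) G(2,5,1)]) (use t in \<open>simp_all add: field_simps\<close>)
    have "(t, 0) \<in> G"
      by (rule meet_closedD[OF G(4) diag G(2,3,1)]) (use t in \<open>simp_all add: field_simps\<close>)
    then show False using bottom t by blast
  qed
  have top: False if t: "(t, 1) \<in> G" "0 < t" "t < 1" for t
  proof -
    have "(1 - t, 0) \<in> G"
      by (rule meet_closedD[OF t(1) mid G(2,3,1)]) (simp_all add: field_simps)
    then show False using bottom[of "1 - t"] t by auto
  qed
  have right: False if t: "(1, t) \<in> G" "0 < t" "t < 1" for t
  proof -
    have "(0, 1 - t) \<in> G"
      by (rule meet_closedD[OF t(1) mid G(2,4,1)]) (simp_all add: field_simps)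
    then show False using left[of "1 - t"] t by auto
  qed
  have interior: "x = 1/2 \<and> y = 1/2" if xy: "(x, y) \<in> G" "0 < x" "x < 1" "0 < y" "y < 1" for x y
  proof -
    have "\<not> y < x"
    proof
      assume "y < x"
      have "(1, y / x) \<in> G"
        by (rule meet_closedD[OF G(2) xy(1) G(3,5,1)]) (use xy in \<open>simp_all add: field_simps\<close>)
      then show False by (rule right) (use xy \<open>y < x\<close> in \<open>auto simp: field_simps\<close>)
    qed
    moreover have "\<not> x < y"
    proof
      assume "x < y"
      have "(x / y, 1) \<in> G"
        by (rule meet_closedD[OF G(2) xy(1) G(4,5,1)]) (use xy in \<open>simp_all add: field_simps\<close>)
      then show False by (rule top) (use xy \<open>x < y\<close> in \<open>auto simp: field_simps\<close>)
    qed
    ultimately have "y = x" by simp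
    have "\<not> x < 1/2"
    proof
      assume "x < 1/2"
      have "(x / (1 - x), 0) \<in> G"
        by (rule meet_closedD[OF G(4) xy(1) G(2,3,1)])
          (use xy \<open>y = x\<close> in \<open>simp_all add: field_simps\<close>)
      then show False by (rule bottom) (use xy \<open>x < 1/2\<close> in \<open>auto simp: field_simps\<close>)
    qed
    moreover have "\<not> 1/2 < x"
    proof
      assume "1/2 < x"
      have "(1, (2 * x - 1) / x) \<in> G"
        by (rule meet_closedD[OF G(4) xy(1) G(3,5,1)])
          (use xy \<open>y = x\<close> in \<open>simp_all add: field_simps\<close>)
      then show False by (rule right) (use xy \<open>1/2 < x\<close> in \<open>auto simp: field_simps\<close>)
    qed
    ultimately show ?thesis using \<open>y = x\<close> by simp
  qed
  have "(x, y) \<in> {(0, 0), (1, 0), (0, 1), (1, 1), (1/2, 1/2)}" if xy: "(x, y) \<in> G" for x y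
  proof -
    have b: "0 \<le> x" "x \<le> 1" "0 \<le> y" "y \<le> 1" using G_square[OF xy] by auto
    consider "y = 0" | "y = 1" | "x = 0" | "x = 1" | "0 < x" "x < 1" "0 < y" "y < 1"
      using b by linarith
    then show ?thesis
    proof cases
      case 1
      then have "x = 0 \<or> x = 1" using bottom[of x] xy b by fastforce
      then show ?thesis using 1 by blast
    next
      case 2
      then have "x = 0 \<or> x = 1" using top[of x] xy b by fastforce
      then show ?thesis using 2 by blast
    next
      case 3
      then have "y = 0 \<or> y = 1" using left[of y] xy b by fastforce
      then show ?thesis using 3 by blast
    next
      case 4
      then have "y = 0 \<or> y = 1" using right[of y] xy b by fastforce
      then show ?thesis using 4 by blast
    next
      case 5
      then show ?thesis using interior[OF xy] by blast
    qed
  qed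
  then have "G \<subseteq> {(0, 0), (1, 0), (0, 1), (1, 1), (1/2, 1/2)}" by (rule subrelI)
  then show ?thesis using G mid by blast
qed


section \<open>Finite sets closed under intersection\<close>

text \<open>If \<open>x < 1\<close>, the line from \<open>(1, 0)\<close> through the point climbs so steeply that it meets the axis
  \<open>x = 0\<close> above height \<open>1\<close>, outside the box; \<open>y < 1\<close> is symmetric.\<close>
lemma point_beyond_side_completes_square:
  assumes G: "meet_closed G" "(0, 0) \<in> G" "(1, 0) \<in> G" "(0, 1) \<in> G"
    and box: "\<And>x y. (x, y) \<in> G \<Longrightarrow> \<bar>x\<bar> \<le> 1 \<and> \<bar>y\<bar> \<le> 1"
    and xy: "(x, y) \<in> G" "x + y > 1"
  shows "x = 1 \<and> y = 1"
proof (intro conjI; rule ccontr)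
  assume "x \<noteq> 1"
  then have "x < 1" using box[OF xy(1)] by auto
  have "(0, y / (1 - x)) \<in> G"
    by (rule meet_closedD[OF G(3) xy(1) G(2,4,1)]) (use \<open>x < 1\<close> in \<open>simp_all add: field_simps\<close>)
  moreover have "y / (1 - x) > 1" using \<open>x < 1\<close> xy(2) by (simp add: field_simps)
  ultimately show False using box[of 0 "y / (1 - x)"] by linarith
next
  assume "y \<noteq> 1"
  then have "y < 1" using box[OF xy(1)] by auto
  have "(x / (1 - y), 0) \<in> G"
    by (rule meet_closedD[OF G(4) xy(1) G(2,3,1)]) (use \<open>y < 1\<close> in \<open>simp_all add: field_simps\<close>)
  moreover have "x / (1 - y) > 1" using \<open>y < 1\<close> xy(2) by (simp add: field_simps)
  ultimately show False using box[of "x / (1 - y)" 0] by linarith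
qed

definition max_triangle :: "(real^2) set \<Rightarrow> real^2 \<Rightarrow> real^2 \<Rightarrow> real^2 \<Rightarrow> bool" where
  "max_triangle F a b c \<longleftrightarrow> a \<in> F \<and> b \<in> F \<and> c \<in> F \<and> area a b c \<noteq> 0 \<and>
     (\<forall>p\<in>F. \<forall>q\<in>F. \<forall>r\<in>F. \<bar>area p q r\<bar> \<le> \<bar>area a b c\<bar>)"

lemma max_triangle_exists:
  assumes "finite F" "\<not> collinear F"
  obtains a b c where "max_triangle F a b c"
proof -
  define A where "A = (\<lambda>(p, q, r). \<bar>area p q r\<bar>) ` (F \<times> F \<times> F)"
  have "finite A" using assms(1) by (simp add: A_def)
  obtain p where "p \<in> F" using assms(2) by fastforce
  then obtain q r where "q \<in> F" "r \<in> F" "area p q r \<noteq> 0"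
    using not_collinear_obtains[OF assms(2)] by blast
  with \<open>p \<in> F\<close> have pos: "\<bar>area p q r\<bar> \<in> A" "\<bar>area p q r\<bar> > 0" by (force simp: A_def)+
  have Max_mem: "Max A \<in> A" using pos(1) \<open>finite A\<close> by (intro Max_in) auto
  have "Max A > 0" using pos Max_ge[OF \<open>finite A\<close> pos(1)] by linarith
  obtain a b c where abc: "a \<in> F" "b \<in> F" "c \<in> F" "Max A = \<bar>area a b c\<bar>"
    using Max_mem by (auto simp: A_def)
  have "\<bar>area p q r\<bar> \<le> Max A" if "p \<in> F" "q \<in> F" "r \<in> F" for p q r
    using that \<open>finite A\<close> by (intro Max_ge) (auto simp: A_def intro!: image_eqI[of _ _ "(p, q, r)"])
  then show ?thesis
    using abc \<open>Max A > 0\<close> by (intro that[of a b c]) (simp add: max_triangle_def)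
qed

lemma max_triangle_permute:
  assumes "max_triangle F a b c"
  shows "max_triangle F b a c" "max_triangle F c a b"
proof -
  have "area b a c = - area a b c" "area c a b = area a b c"
    by (simp_all add: area_def algebra_simps)
  then show "max_triangle F b a c" "max_triangle F c a b"
    using assms by (simp_all add: max_triangle_def)
qed

lemma max_triangle_coordinates:
  assumes "max_triangle F a b c" "frame a b c (p1, p2) \<in> F" "frame a b c (q1, q2) \<in> F"
    "frame a b c (r1, r2) \<in> F"
  shows "\<bar>(q1 - p1) * (r2 - p2) - (q2 - p2) * (r1 - p1)\<bar> \<le> 1"
proof -
  have "\<bar>area a b c * ((q1 - p1) * (r2 - p2) - (q2 - p2) * (r1 - p1))\<bar> \<le> \<bar>area a b c\<bar>"
    using assms area_frame[of a b c p1 p2 q1 q2 r1 r2] unfolding max_triangle_def by metis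
  then show ?thesis using assms(1) by (simp add: abs_mult max_triangle_def mult_le_cancel_left1)
qed

lemma frame_vertices:
  "frame a b c (0, 0) = a" "frame a b c (1, 0) = b" "frame a b c (0, 1) = c"
  "frame a b c (1, 1) = b + c - a" "frame a b c (1/2, 1/2) = midpoint b c"
  by (simp_all add: vec_eq_iff forall_2 frame_nth midpoint_def field_simps)

text \<open>The triangles on the sides of \<open>abc\<close> bound the coordinates by \<open>1\<close> in absolute value. Once
  \<open>(1, 1)\<close> is known to be present, the triangles on the two sides through it give the missing
  bounds \<open>x \<ge> 0\<close> and \<open>y \<ge> 0\<close>.\<close>
lemma parallelogram_if_point_beyond_side:
  assumes F: "finite F" "line_intersections F \<subseteq> F" and abc: "max_triangle F a b c"
    and xy: "frame a b c (x, y) \<in> F" "x + y > 1"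
  shows "F = {a, b, c, b + c - a, midpoint b c}"
proof -
  let ?f = "frame a b c"
  define G where "G = ?f -` F"
  have area: "area a b c \<noteq> 0" using abc by (simp add: max_triangle_def)
  have G: "meet_closed G" "(0, 0) \<in> G" "(1, 0) \<in> G" "(0, 1) \<in> G"
    using meet_closed_frame[OF F(2) area] abc by (auto simp: G_def frame_vertices max_triangle_def)
  have G_max: "\<bar>(q1 - p1) * (r2 - p2) - (q2 - p2) * (r1 - p1)\<bar> \<le> 1"
    if "(p1, p2) \<in> G" "(q1, q2) \<in> G" "(r1, r2) \<in> G" for p1 p2 q1 q2 r1 r2
    using max_triangle_coordinates[OF abc] that by (simp add: G_def)
  have box: "\<bar>u\<bar> \<le> 1 \<and> \<bar>v\<bar> \<le> 1" if "(u, v) \<in> G" for u v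
    using G_max[OF G(2,3) that] G_max[OF G(2,4) that] by simp
  have "x = 1 \<and> y = 1"
    by (rule point_beyond_side_completes_square[OF G box]) (use xy in \<open>auto simp: G_def\<close>)
  then have one: "(1, 1) \<in> G" using xy by (simp add: G_def)
  have "inj ?f" using frame_eq_iff[OF area] by (auto simp: inj_def)
  then have "finite G" using F(1) by (simp add: G_def finite_vimageI)
  have square: "0 \<le> u \<and> u \<le> 1 \<and> 0 \<le> v \<and> v \<le> 1" if "(u, v) \<in> G" for u v
    using box[OF that] G_max[OF one G(3) that] G_max[OF one G(4) that] by auto
  have "G = {(0, 0), (1, 0), (0, 1), (1, 1), (1/2, 1/2)}"
    by (rule square_only_corners_and_centre[OF G one \<open>finite G\<close> square])
  moreover have "F = ?f ` G"
    unfolding G_def using frame_coordinates[OF area] by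
      (metis UNIV_I image_vimage_eq inf.orderE rangeI subsetI)
  ultimately show ?thesis by (simp add: frame_vertices)
qed

lemma frame_line_collinear:
  assumes "area a b c \<noteq> 0" "\<alpha> \<noteq> 0 \<or> \<beta> \<noteq> 0"
    and "\<And>x y. frame a b c (x, y) \<in> C \<Longrightarrow> \<alpha> * x + \<beta> * y = \<gamma>"
  shows "collinear C"
proof (rule ccontr)
  assume "\<not> collinear C"
  then obtain p where "p \<in> C" by fastforce
  obtain q r where qr: "q \<in> C" "r \<in> C" "area p q r \<noteq> 0"
    using not_collinear_obtains[OF \<open>\<not> collinear C\<close> \<open>p \<in> C\<close>] by blast
  obtain p1 p2 q1 q2 r1 r2 where eqs: "p = frame a b c (p1, p2)" "q = frame a b c (q1, q2)"
    "r = frame a b c (r1, r2)"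
    using frame_coordinates[OF assms(1)] by metis
  then have on: "\<alpha> * (q1 - p1) = \<beta> * (p2 - q2)" "\<alpha> * (r1 - p1) = \<beta> * (p2 - r2)"
    using assms(3)[of p1 p2] assms(3)[of q1 q2] assms(3)[of r1 r2] qr \<open>p \<in> C\<close>
    by (simp_all add: algebra_simps)
  have "\<alpha> * ((q1 - p1) * (r2 - p2) - (q2 - p2) * (r1 - p1)) =
      \<alpha> * (q1 - p1) * (r2 - p2) - (q2 - p2) * (\<alpha> * (r1 - p1))"
    by (simp add: algebra_simps)
  then have "\<alpha> * ((q1 - p1) * (r2 - p2) - (q2 - p2) * (r1 - p1)) = 0"
    unfolding on by (simp add: algebra_simps)
  moreover have "\<beta> * ((q1 - p1) * (r2 - p2) - (q2 - p2) * (r1 - p1)) =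
      (q1 - p1) * - (\<beta> * (p2 - r2)) + (r1 - p1) * (\<beta> * (p2 - q2))"
    by (simp add: algebra_simps)
  then have "\<beta> * ((q1 - p1) * (r2 - p2) - (q2 - p2) * (r1 - p1)) = 0"
    unfolding on[symmetric] by (simp add: algebra_simps)
  ultimately have "(q1 - p1) * (r2 - p2) - (q2 - p2) * (r1 - p1) = 0"
    using assms(2) by auto
  then show False using qr(3) by (simp add: eqs area_frame)
qed

text \<open>Take a triangle of maximal area. Each of its three sides can play the part of \<open>bc\<close> after
  a permutation of the vertices, so either a point beyond some side makes \<open>F\<close> a centred
  parallelogram, or \<open>F\<close> lies inside the triangle.\<close>
lemma finite_fixed_set_cases:
  assumes F: "finite F" "\<not> collinear F" "line_intersections F \<subseteq> F"
  shows "(\<exists>p C. F \<subseteq> insert p C \<and> collinear C) \<or>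
    (\<exists>a b c. \<not> collinear {a, b, c} \<and> F = {a, b, c, b + c - a, midpoint b c})"
proof (rule disjCI)
  assume no_par: "\<not> (\<exists>a b c. \<not> collinear {a, b, c} \<and> F = {a, b, c, b + c - a, midpoint b c})"
  have side: "x + y \<le> 1" if "max_triangle F a b c" "frame a b c (x, y) \<in> F" for a b c x y
  proof (rule ccontr)
    assume "\<not> x + y \<le> 1"
    then have "F = {a, b, c, b + c - a, midpoint b c}"
      using parallelogram_if_point_beyond_side[OF F(1,3) that] by simp
    moreover have "\<not> collinear {a, b, c}"
      using that(1) by (simp add: max_triangle_def collinear_iff_area)
    ultimately show False using no_par by blast
  qed
  obtain a b c where abc: "max_triangle F a b c" using max_triangle_exists[OF F(1,2)] .
  let ?f = "frame a b c"
  have area: "area a b c \<noteq> 0" using abc by (simp add: max_triangle_def)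
  have triangle: "0 \<le> x \<and> 0 \<le> y \<and> x + y \<le> 1" if "(x, y) \<in> ?f -` F" for x y
  proof -
    have "?f (x, y) = frame b a c (1 - x - y, y)" "?f (x, y) = frame c a b (1 - x - y, x)"
      by (simp_all add: vec_eq_iff frame_nth algebra_simps)
    then show ?thesis
      using side[OF abc, of x y] side[OF max_triangle_permute(1)[OF abc], of "1 - x - y" y]
        side[OF max_triangle_permute(2)[OF abc], of "1 - x - y" x] that by auto
  qed
  have collinear: "\<exists>p C. F \<subseteq> insert p C \<and> collinear C"
    if "\<alpha> \<noteq> 0 \<or> \<beta> \<noteq> 0" "\<And>x y. ?f (x, y) \<in> F \<Longrightarrow> (x, y) = (u, v) \<or> \<alpha> * x + \<beta> * y = \<gamma>"
    for u v \<alpha> \<beta> \<gamma>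
  proof (intro exI conjI)
    show "F \<subseteq> insert (?f (u, v)) (F - {?f (u, v)})" by blast
    show "collinear (F - {?f (u, v)})"
      by (rule frame_line_collinear[OF area that(1), of _ \<gamma>]) (use that(2) in blast)
  qed
  have "(\<forall>x y. (x, y) \<in> ?f -` F \<longrightarrow> (x, y) = (1, 0) \<or> x = 0) \<or>
    (\<forall>x y. (x, y) \<in> ?f -` F \<longrightarrow> (x, y) = (0, 1) \<or> y = 0) \<or>
    (\<forall>x y. (x, y) \<in> ?f -` F \<longrightarrow> (x, y) = (0, 0) \<or> x + y = 1)"
    using abc by (intro triangle_all_but_one_on_edge[OF meet_closed_frame[OF F(3) area] _ _ _ triangle])
      (auto simp: frame_vertices max_triangle_def)
  then show "\<exists>p C. F \<subseteq> insert p C \<and> collinear C"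
    using collinear[of 1 0 1 0 0] collinear[of 0 1 0 1 0] collinear[of 1 1 0 0 1] by auto
qed

section \<open>The stable configurations\<close>

text \<open>A spanned line either joins \<open>p\<close> to a point of \<open>C\<close> or is the line of \<open>C\<close> itself. Any two distinct
  lines of these kinds share a point of the set, which is then their only common point.\<close>
lemma line_intersections_near_collinear:
  assumes "collinear C"
  shows "line_intersections (insert p C) \<subseteq> insert p C"
proof
  fix x assume "x \<in> line_intersections (insert p C)"
  then obtain L M where LM: "L \<in> spanned_lines (insert p C)" "M \<in> spanned_lines (insert p C)"
    "L \<noteq> M" "x \<in> L" "x \<in> M"
    unfolding line_intersections_def by blast
  have shape: "p \<in> K \<and> (\<exists>u\<in>C. u \<in> K) \<or> K = affine hull C"
    if span: "K \<in> spanned_lines (insert p C)" for K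
  proof -
    obtain q r where K: "K = affine hull {q, r}" "q \<in> insert p C" "r \<in> insert p C" "q \<noteq> r"
      using span unfolding spanned_lines_def by blast
    show ?thesis
    proof (cases "q \<in> C \<and> r \<in> C")
      case True
      have "y \<in> affine hull {q, r}" if "y \<in> C" for y
      proof -
        have "collinear {q, r, y}" using assms True that by (auto intro: collinear_subset)
        then show ?thesis using K(4) by (simp add: collinear_3_affine_hull)
      qed
      then have "affine hull C \<subseteq> K" unfolding K(1) by (intro hull_minimal subsetI) auto
      moreover have "K \<subseteq> affine hull C" using True by (simp add: K(1) hull_mono)
      ultimately show ?thesis by blast
    next
      case False
      then show ?thesis using K by (auto simp: hull_inc)
    qed
  qed
  have "\<exists>z \<in> insert p C. z \<in> L \<and> z \<in> M"
    using shape[OF LM(1)] shape[OF LM(2)] LM(3) by (auto intro: hull_inc)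
  then show "x \<in> insert p C"
    using distinct_lines_meet_once[OF LM(1-3)] LM(4,5) by metis
qed

text \<open>In coordinates, a square and its centre span just six lines: four sides and two diagonals. Their
  pairwise meets are read off from the equations.\<close>
lemma line_intersections_parallelogram:
  assumes "\<not> collinear {a, b, c}"
  defines "P \<equiv> {a, b, c, b + c - a, midpoint b c}"
  shows "line_intersections P \<subseteq> P"
proof
  let ?f = "frame a b c"
  let ?Q = "{(0, 0), (1, 0), (0, 1), (1, 1), (1/2, 1/2)} :: (real \<times> real) set"
  have area: "area a b c \<noteq> 0" using assms(1) by (simp add: collinear_iff_area)
  have P: "P = ?f ` ?Q" by (simp add: P_def frame_vertices)
  define line_of :: "real \<Rightarrow> real \<Rightarrow> real \<Rightarrow> real \<Rightarrow> (real \<times> real) set" where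
    "line_of u1 u2 v1 v2 = {z. (v1 - u1) * (snd z - u2) = (v2 - u2) * (fst z - u1)}" for u1 u2 v1 v2
  define lines where "lines = {line_of 0 0 1 0, line_of 0 1 1 1, line_of 0 0 0 1, line_of 1 0 1 1,
    line_of 0 0 1 1, line_of 1 0 0 1}"
  have line: "?f ` line_of u1 u2 v1 v2 = affine hull {?f (u1, u2), ?f (v1, v2)}"
    "?f (u1, u2) \<noteq> ?f (v1, v2)" if "(u1, u2) \<noteq> (v1, v2)" for u1 u2 v1 v2
  proof -
    show ne: "?f (u1, u2) \<noteq> ?f (v1, v2)" using that frame_eq_iff[OF area] by auto
    have mem: "?f (z1, z2) \<in> affine hull {?f (u1, u2), ?f (v1, v2)} \<longleftrightarrow> (z1, z2) \<in> line_of u1 u2 v1 v2"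
      for z1 z2
      using ne area by (simp add: mem_line_iff_area area_frame line_of_def)
    show "?f ` line_of u1 u2 v1 v2 = affine hull {?f (u1, u2), ?f (v1, v2)}" (is "_ = ?L")
    proof
      show "?f ` line_of u1 u2 v1 v2 \<subseteq> ?L" using mem by auto
      show "?L \<subseteq> ?f ` line_of u1 u2 v1 v2"
      proof
        fix p assume "p \<in> ?L"
        moreover obtain z1 z2 where "p = ?f (z1, z2)" using frame_coordinates[OF area] .
        ultimately show "p \<in> ?f ` line_of u1 u2 v1 v2" using mem by blast
      qed
    qed
  qed
  have line_lines: "\<exists>u v. ?f ` l = affine hull {u, v} \<and> u \<noteq> v" if "l \<in> lines" for l
  proof -
    have "\<exists>u1 u2 v1 v2. l = line_of u1 u2 v1 v2 \<and> (u1, u2) \<noteq> (v1, v2)"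
      using that unfolding lines_def by (elim insertE emptyE) (intro exI conjI, assumption, simp)+
    then obtain u1 u2 v1 v2 where "l = line_of u1 u2 v1 v2" "(u1, u2) \<noteq> (v1, v2)" by blast
    then show ?thesis using line by blast
  qed
  have in_lines: "\<exists>l\<in>lines. K = ?f ` l" if "K \<in> spanned_lines P" for K
  proof -
    obtain u v where K: "u \<in> ?Q" "v \<in> ?Q" "?f u \<noteq> ?f v" "K = affine hull {?f u, ?f v}"
      using \<open>K \<in> spanned_lines P\<close> unfolding P spanned_lines_def by blast
    have "\<exists>l\<in>lines. u \<in> l \<and> v \<in> l"
      using K(1,2) unfolding lines_def line_of_def by (elim insertE emptyE) simp_all
    then obtain l where l: "l \<in> lines" "u \<in> l" "v \<in> l" by blast
    obtain p q where "?f ` l = affine hull {p, q}" "p \<noteq> q" using line_lines[OF l(1)] by blast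
    then have "?f ` l = affine hull {?f u, ?f v}"
      by (rule line_eqI) (use l K(3) in simp_all)
    then show ?thesis using l(1) K(4) by blast
  qed
  fix x assume "x \<in> line_intersections P"
  then obtain L M where LM: "L \<in> spanned_lines P" "M \<in> spanned_lines P" "L \<noteq> M" "x \<in> L" "x \<in> M"
    unfolding line_intersections_def by blast
  then obtain l m where lm: "l \<in> lines" "m \<in> lines" "L = ?f ` l" "M = ?f ` m"
    using in_lines by meson
  obtain z1 z2 where z: "x = ?f (z1, z2)" using frame_coordinates[OF area] by blast
  have "(z1, z2) \<in> l" "(z1, z2) \<in> m" "l \<noteq> m"
    using LM lm z frame_eq_iff[OF area] by auto
  then have "(z1, z2) \<in> ?Q"
    using lm(1,2) unfolding lines_def line_of_def by (elim insertE emptyE) auto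
  then show "x \<in> P" unfolding P z by blast
qed

section \<open>Parallelograms\<close>
lemma affine_parallel_cross:
  fixes p q r s :: "real^2"
  assumes "affine_parallel (affine hull {p, q}) (affine hull {r, s})"
  shows "(q$1 - p$1) * (s$2 - r$2) = (q$2 - p$2) * (s$1 - r$1)"
proof -
  obtain v where v: "\<And>x. x \<in> affine hull {p, q} \<Longrightarrow> v + x \<in> affine hull {r, s}"
    using assms unfolding affine_parallel_expl by blast
  have "area r s x = 0" if "x \<in> affine hull {r, s}" for x
    using that mem_line_iff_area[of r s x] by (cases "r = s") (auto simp: area_def)
  then have "area r s (v + p) = 0" "area r s (v + q) = 0"
    using v by (simp_all add: hull_inc)
  then show ?thesis by (simp add: area_def algebra_simps)
qed

text \<open>In coordinates based at \<open>b\<close>, parallelism of either pair of opposite sides fixes one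
  coordinate of \<open>d\<close> to be \<open>1\<close>.\<close>
lemma parallelogram_iff:
  "parallelogram a b c d \<longleftrightarrow> \<not> collinear {a, b, c} \<and> d = a + c - b"
proof (intro iffI conjI)
  assume par: "parallelogram a b c d"
  then show nc: "\<not> collinear {a, b, c}" by (simp add: parallelogram_def)
  have area: "area b a c \<noteq> 0" using nc by (metis collinear_iff_area insert_commute)
  obtain x y where d: "d = frame b a c (x, y)" using frame_coordinates[OF area] .
  have "(b$1 - a$1) * (d$2 - c$2) = (b$2 - a$2) * (d$1 - c$1)"
    "(c$1 - b$1) * (a$2 - d$2) = (c$2 - b$2) * (a$1 - d$1)"
    using par affine_parallel_cross unfolding parallelogram_def by blast+
  then have "area b a c * (y - 1) = 0" "area b a c * (x - 1) = 0"
    unfolding d frame_nth area_def by algebra+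
  then have "x = 1" "y = 1" using area by auto
  then show "d = a + c - b" using d by (simp add: frame_vertices)
next
  assume *: "\<not> collinear {a, b, c} \<and> d = a + c - b"
  have "{c, d} = (\<lambda>x. (c - b) + x) ` {b, a}" "{d, a} = (\<lambda>x. (a - b) + x) ` {c, b}"
    using * by (auto simp: algebra_simps)
  then have "affine hull {c, d} = (\<lambda>x. (c - b) + x) ` (affine hull {a, b})"
    "affine hull {d, a} = (\<lambda>x. (a - b) + x) ` (affine hull {b, c})"
    by (simp_all only: affine_hull_translation insert_commute)
  then show "parallelogram a b c d"
    using * unfolding parallelogram_def affine_parallel_def by blast
qed

lemma parallelogram_diagonals_meet:
  fixes a b c :: "real^2"
  assumes "\<not> collinear {a, b, c}"
  shows "closed_segment a c \<inter> closed_segment b (a + c - b) = {midpoint a c}"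
proof -
  let ?d = "a + c - b"
  have mid: "midpoint a c = midpoint b ?d" by (simp add: midpoint_def)
  have area: "area a b c \<noteq> 0" using assms by (simp add: collinear_iff_area)
  have "x = midpoint a c" if x: "x \<in> closed_segment a c" "x \<in> closed_segment b ?d" for x
  proof -
    obtain u where u: "x = (1 - u) *\<^sub>R a + u *\<^sub>R c" using x(1) by (auto simp: in_segment)
    obtain v where v: "x = (1 - v) *\<^sub>R b + v *\<^sub>R ?d" using x(2) by (auto simp: in_segment)
    have "x = frame a b c (0, u)"
      unfolding u by (simp add: vec_eq_iff frame_nth algebra_simps)
    moreover have "x = frame a b c (1 - 2 * v, v)"
      unfolding v by (simp add: vec_eq_iff frame_nth algebra_simps)
    ultimately have "frame a b c (0, u) = frame a b c (1 - 2 * v, v)" by simp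
    then have "1 - 2 * v = 0" "u = v" using frame_eq_iff[OF area] by simp_all
    then have half: "u = 1/2" by simp
    show ?thesis unfolding u half by (simp add: midpoint_def scaleR_add_right)
  qed
  moreover have "midpoint a c \<in> closed_segment a c" by simp
  moreover have "midpoint a c \<in> closed_segment b ?d"
    unfolding mid by (rule midpoint_in_closed_segment)
  ultimately show ?thesis by blast
qed

section \<open>Sets of finite order\<close>
lemma intersection_order_finite_iff:
  "intersection_order S < \<infinity> \<longleftrightarrow>
    (\<exists>n. (line_intersections ^^ Suc n) S = (line_intersections ^^ n) S)"
proof -
  have "intersection_order S < \<infinity> \<longleftrightarrow>
      (\<exists>n. 0 < n \<and> (line_intersections ^^ n) S = (line_intersections ^^ (n - 1)) S)"
    by (simp add: intersection_order_def Let_def)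
  also have "\<dots> \<longleftrightarrow> (\<exists>n. (line_intersections ^^ Suc n) S = (line_intersections ^^ n) S)"
    by (metis Suc_pred' diff_Suc_1 zero_less_Suc)
  finally show ?thesis .
qed

lemma iterate_superset:
  assumes "\<not> collinear S"
  shows "S \<subseteq> (line_intersections ^^ n) S"
proof (induction n)
  case (Suc n)
  then have "\<not> collinear ((line_intersections ^^ n) S)" using assms collinear_subset by blast
  with Suc show ?case using subset_line_intersections by fastforce
qed simp

lemma iterate_finite: "finite S \<Longrightarrow> finite ((line_intersections ^^ n) S)"
  by (induction n) (simp_all add: finite_line_intersections)

lemma near_collinear_subset:
  assumes "\<not> collinear S" "S \<subseteq> insert p C" "collinear C"
  shows "\<exists>C p. S = insert p C \<and> collinear C \<and> \<not> collinear (insert p C)"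
proof -
  have "p \<in> S" using assms collinear_subset by blast
  then have "S = insert p (S - {p})" by blast
  moreover have "collinear (S - {p})" using assms by (auto intro: collinear_subset)
  ultimately show ?thesis using assms(1) by metis
qed

theorem corollary2p3:
  fixes S :: "(real^2) set"
  assumes "finite S"
  shows "intersection_order S < \<infinity> \<longleftrightarrow>
      S = {} \<or>
      collinear S \<or>
      (\<exists>C p. S = insert p C \<and> collinear C \<and> \<not> collinear (insert p C)) \<or>
      (\<exists>a b c d. parallelogram a b c d \<and> S = {a, b, c, d}) \<or>
      (\<exists>a b c d m. parallelogram a b c d \<and>
         closed_segment a c \<inter> closed_segment b d = {m} \<and> S = {a, b, c, d, m})"
    (is "?fin \<longleftrightarrow> _ \<or> ?coll \<or> ?near \<or> ?par \<or> ?parm")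
proof (intro iffI)
  assume ?fin
  show "S = {} \<or> ?coll \<or> ?near \<or> ?par \<or> ?parm"
  proof (cases "collinear S")
    case False
    obtain n where n: "(line_intersections ^^ Suc n) S = (line_intersections ^^ n) S"
      using \<open>?fin\<close> unfolding intersection_order_finite_iff by blast
    define F where "F = (line_intersections ^^ n) S"
    have F: "finite F" "S \<subseteq> F" "line_intersections F \<subseteq> F"
      using iterate_finite[OF assms] iterate_superset[OF False] n by (auto simp: F_def)
    then have "\<not> collinear F" using False collinear_subset by blast
    have near: ?thesis if "S \<subseteq> insert p C" "collinear C" for p C
      by (rule disjI2[OF disjI2[OF disjI1[OF near_collinear_subset[OF False that]]]])
    from finite_fixed_set_cases[OF F(1) \<open>\<not> collinear F\<close> F(3)] show ?thesis
    proof (elim disjE exE conjE)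
      fix p C assume "F \<subseteq> insert p C" "collinear C"
      then show ?thesis by (intro near[OF order_trans[OF F(2)]])
    next
      fix a b c assume abc: "\<not> collinear {a, b, c}" "F = {a, b, c, b + c - a, midpoint b c}"
      let ?d = "b + c - a" and ?m = "midpoint b c"
      have par: "parallelogram a b ?d c"
        using abc(1) unfolding parallelogram_iff collinear_iff_area
        by (simp add: area_def algebra_simps)
      have meet: "closed_segment a ?d \<inter> closed_segment b c = {?m}"
        using parallelogram_diagonals_meet[of b a c] abc(1) by (simp add: insert_commute Int_commute)
      have diagonals: "collinear {b, c, ?m}" "collinear {a, ?d, ?m}"
        unfolding collinear_iff_area by (simp_all add: area_def midpoint_def field_simps)
      \<comment> \<open>If a corner of the parallelogram is missing from \<open>S\<close>, then all of \<open>S\<close> except the opposite corner lies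
        on the other diagonal.\<close>
      consider "S \<subseteq> insert ?d {b, c, ?m}" | "S \<subseteq> insert c {a, ?d, ?m}"
        | "S \<subseteq> insert b {a, ?d, ?m}" | "S \<subseteq> insert a {b, c, ?m}" | "{a, b, ?d, c} \<subseteq> S"
        using F(2) abc(2) by blast
      then show ?thesis
      proof cases
        case 5
        then have "S = {a, b, ?d, c} \<or> S = {a, b, ?d, c, ?m}" using F(2) abc(2) by blast
        then have "?par \<or> ?parm" using par meet by metis
        then show ?thesis by (rule disjI2[OF disjI2[OF disjI2]])
      qed (rule near, assumption, rule diagonals)+
    qed
  qed simp
next
  have stable: ?fin if "line_intersections S \<subseteq> S" "\<not> collinear S"
    using subset_line_intersections[OF that(2)] that(1)
    unfolding intersection_order_finite_iff by (intro exI[of _ 0]) auto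
  assume config: "S = {} \<or> ?coll \<or> ?near \<or> ?par \<or> ?parm"
  show ?fin
  proof (cases "collinear S")
    case True
    then have "(line_intersections ^^ Suc 1) S = (line_intersections ^^ 1) S"
      by (simp add: line_intersections_collinear)
    then show ?thesis unfolding intersection_order_finite_iff by blast
  next
    case False
    from config show ?thesis
    proof (elim disjE exE conjE)
      fix C p assume "S = insert p C" "collinear C"
      then show ?thesis using stable False line_intersections_near_collinear by simp
    next
      fix a b c d assume abcd: "parallelogram a b c d" "S = {a, b, c, d}"
      then have nc: "\<not> collinear {b, a, c}" and d: "d = a + c - b"
        by (simp_all add: parallelogram_iff insert_commute)
      define P where "P = {b, a, c, a + c - b, midpoint a c}"
      have P: "line_intersections P \<subseteq> P" "P = insert (midpoint a c) S"
        using line_intersections_parallelogram[OF nc] abcd(2) d by (auto simp: P_def)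
      have "S \<subseteq> line_intersections S" using subset_line_intersections False by blast
      moreover have "line_intersections S \<subseteq> P" using line_intersections_mono[of S P] P by blast
      ultimately consider "line_intersections S = S" | "line_intersections S = P"
        using P(2) by blast
      then show ?thesis
      proof cases
        case 1
        then show ?thesis using stable False by simp
      next
        case 2
        have "\<not> collinear P" using P(2) False collinear_subset by blast
        then have "line_intersections P = P" using P(1) subset_line_intersections by blast
        then have "(line_intersections ^^ Suc 1) S = (line_intersections ^^ 1) S" using 2 by simp
        then show ?thesis unfolding intersection_order_finite_iff by blast
      qed
    next
      fix a b c d m assume *: "parallelogram a b c d"
        "closed_segment a c \<inter> closed_segment b d = {m}" "S = {a, b, c, d, m}"
      then have nc: "\<not> collinear {a, b, c}" and d: "d = a + c - b"
        by (simp_all add: parallelogram_iff)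
      have "m = midpoint a c" using parallelogram_diagonals_meet[OF nc] *(2) d by simp
      then have "S = {b, a, c, a + c - b, midpoint a c}" using *(3) d by blast
      then show ?thesis
        using line_intersections_parallelogram[of b a c] nc stable False
        by (simp add: insert_commute)
    qed (use False in simp_all)
  qed
qed

end
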